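(* Let $R$ be a ring with a primitive idempotent $e$ such that $eRe$ is not a division ring. Then $R$ is VNL if and only if $R\cong\left(\begin{array}{cc} S & X\\ Y & L\end{array}\right)$, where $L$ is a local ring, $S$ is a regular ring and $XY=0$.
   Context: Rings are associative with identity. An element $a$ of a ring $R$ is (von Neumann) regular if $a=aba$ for some $b\in R$; a ring is regular if all its elements are regular; the zero ring is regular (so $S=0$ is allowed). A ring $R$ is VNL if for each $a\in R$, either $a$ or $1-a$ is regular in $R$. A ring written $\left(\begin{array}{cc} S & X\\ Y & L\end{array}\right)$ is a generalized matrix ring (Morita context ring): $S,L$ are rings, $X$ is an $(S,L)$-bimodule, $Y$ is an $(L,S)$-bimodule, with bimodule products $X\times Y\to S$ and $Y\times X\to L$ making the matrix operations an associative ring structure; equivalently it is a ring $Q$ with an idempotent $g$ such that $S=gQg$, $L=(1-g)Q(1-g)$, $X=gQ(1-g)$, $Y=(1-g)Qg$. $XY$ denotes the set of finite sums of products $xy$ with $x\in X$, $y\in Y$. *)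

theory Defs
  imports "HOL-Algebra.QuotRing"
begin

section \<open>Von Neumann regular and VNL rings\<close>

text \<open>The locale \<open>ring\<close> of HOL-Algebra is the class of all associative rings with identity:
  commutativity is not assumed and the zero ring is included.\<close>

definition vn_regular :: "('a, 'm) ring_scheme \<Rightarrow> 'a \<Rightarrow> bool" where
  "vn_regular R a \<longleftrightarrow> a \<in> carrier R \<and> (\<exists>b \<in> carrier R. a = a \<otimes>\<^bsub>R\<^esub> b \<otimes>\<^bsub>R\<^esub> a)"

definition regular_ring :: "('a, 'm) ring_scheme \<Rightarrow> bool" where
  "regular_ring R \<longleftrightarrow> ring R \<and> (\<forall>a \<in> carrier R. vn_regular R a)"

definition VNL_ring :: "('a, 'm) ring_scheme \<Rightarrow> bool" where
  "VNL_ring R \<longleftrightarrow>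
     ring R \<and> (\<forall>a \<in> carrier R. vn_regular R a \<or> vn_regular R (\<one>\<^bsub>R\<^esub> \<ominus>\<^bsub>R\<^esub> a))"


section \<open>Division rings and local rings\<close>

definition division_ring :: "('a, 'm) ring_scheme \<Rightarrow> bool" where
  "division_ring R \<longleftrightarrow> ring R \<and> \<one>\<^bsub>R\<^esub> \<noteq> \<zero>\<^bsub>R\<^esub> \<and> Units R = carrier R - {\<zero>\<^bsub>R\<^esub>}"

definition left_ideal :: "'a set \<Rightarrow> ('a, 'm) ring_scheme \<Rightarrow> bool" where
  "left_ideal I R \<longleftrightarrow>
     additive_subgroup I R \<and> (\<forall>r \<in> carrier R. \<forall>a \<in> I. r \<otimes>\<^bsub>R\<^esub> a \<in> I)"

definition maximal_left_ideal :: "'a set \<Rightarrow> ('a, 'm) ring_scheme \<Rightarrow> bool" where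
  "maximal_left_ideal I R \<longleftrightarrow>
     left_ideal I R \<and> I \<noteq> carrier R \<and>
     (\<forall>J. left_ideal J R \<and> I \<subseteq> J \<longrightarrow> J = I \<or> J = carrier R)"

text \<open>The ring is not assumed commutative, so one-sided ideals have to be used; \<open>maximalideal\<close> of
  HOL-Algebra is two-sided.  The zero ring has no proper left ideal and hence is not local.\<close>

definition local_ring :: "('a, 'm) ring_scheme \<Rightarrow> bool" where
  "local_ring R \<longleftrightarrow> ring R \<and> (\<exists>!I. maximal_left_ideal I R)"


section \<open>Primitive idempotents and corner rings\<close>

definition idempotent_elem :: "('a, 'm) ring_scheme \<Rightarrow> 'a \<Rightarrow> bool" where
  "idempotent_elem R e \<longleftrightarrow> e \<in> carrier R \<and> e \<otimes>\<^bsub>R\<^esub> e = e"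

definition primitive_idempotent :: "('a, 'm) ring_scheme \<Rightarrow> 'a \<Rightarrow> bool" where
  "primitive_idempotent R e \<longleftrightarrow>
     idempotent_elem R e \<and> e \<noteq> \<zero>\<^bsub>R\<^esub> \<and>
     \<not> (\<exists>f g. idempotent_elem R f \<and> idempotent_elem R g \<and> f \<noteq> \<zero>\<^bsub>R\<^esub> \<and> g \<noteq> \<zero>\<^bsub>R\<^esub> \<and>
              f \<otimes>\<^bsub>R\<^esub> g = \<zero>\<^bsub>R\<^esub> \<and> g \<otimes>\<^bsub>R\<^esub> f = \<zero>\<^bsub>R\<^esub> \<and> e = f \<oplus>\<^bsub>R\<^esub> g)"

text \<open>The ring \<open>eRe\<close>, with the operations of \<open>R\<close> and identity \<open>e\<close>.\<close>

definition corner :: "('a, 'm) ring_scheme \<Rightarrow> 'a \<Rightarrow> ('a, 'm) ring_scheme" where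
  "corner R e = R\<lparr>carrier := {e \<otimes>\<^bsub>R\<^esub> x \<otimes>\<^bsub>R\<^esub> e | x. x \<in> carrier R}, one := e\<rparr>"


section \<open>Generalized matrix rings\<close>

text \<open>As for the record \<open>module\<close> of HOL-Algebra, a bimodule is stored in a ring record of which only
  \<open>carrier\<close>, \<open>zero\<close> and \<open>add\<close> are relevant; the fields \<open>mult\<close> and \<open>one\<close> are never used.\<close>

record ('s, 'l, 'x) bimodule = "'x ring" +
  lsmult :: "['s, 'x] \<Rightarrow> 'x" (infixl \<open>\<triangleright>\<index>\<close> 70)
  rsmult :: "['x, 'l] \<Rightarrow> 'x" (infixl \<open>\<triangleleft>\<index>\<close> 70)

locale bimodule = S: ring S + L: ring L + X: abelian_group X
  for S :: "('s, 'm) ring_scheme" and L :: "('l, 'n) ring_scheme"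
    and X :: "('s, 'l, 'x, 'p) bimodule_scheme" (structure) +
  assumes lsmult_closed: "\<lbrakk>s \<in> carrier S; x \<in> carrier X\<rbrakk> \<Longrightarrow> s \<triangleright> x \<in> carrier X"
    and rsmult_closed: "\<lbrakk>x \<in> carrier X; l \<in> carrier L\<rbrakk> \<Longrightarrow> x \<triangleleft> l \<in> carrier X"
    and lsmult_l_distr: "\<lbrakk>s \<in> carrier S; t \<in> carrier S; x \<in> carrier X\<rbrakk> \<Longrightarrow>
          (s \<oplus>\<^bsub>S\<^esub> t) \<triangleright> x = s \<triangleright> x \<oplus> t \<triangleright> x"
    and lsmult_r_distr: "\<lbrakk>s \<in> carrier S; x \<in> carrier X; y \<in> carrier X\<rbrakk> \<Longrightarrow>
          s \<triangleright> (x \<oplus> y) = s \<triangleright> x \<oplus> s \<triangleright> y"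
    and rsmult_l_distr: "\<lbrakk>x \<in> carrier X; y \<in> carrier X; l \<in> carrier L\<rbrakk> \<Longrightarrow>
          (x \<oplus> y) \<triangleleft> l = x \<triangleleft> l \<oplus> y \<triangleleft> l"
    and rsmult_r_distr: "\<lbrakk>x \<in> carrier X; l \<in> carrier L; m \<in> carrier L\<rbrakk> \<Longrightarrow>
          x \<triangleleft> (l \<oplus>\<^bsub>L\<^esub> m) = x \<triangleleft> l \<oplus> x \<triangleleft> m"
    and lsmult_assoc: "\<lbrakk>s \<in> carrier S; t \<in> carrier S; x \<in> carrier X\<rbrakk> \<Longrightarrow>
          (s \<otimes>\<^bsub>S\<^esub> t) \<triangleright> x = s \<triangleright> (t \<triangleright> x)"
    and rsmult_assoc: "\<lbrakk>x \<in> carrier X; l \<in> carrier L; m \<in> carrier L\<rbrakk> \<Longrightarrow>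
          x \<triangleleft> (l \<otimes>\<^bsub>L\<^esub> m) = (x \<triangleleft> l) \<triangleleft> m"
    and lsmult_one: "x \<in> carrier X \<Longrightarrow> \<one>\<^bsub>S\<^esub> \<triangleright> x = x"
    and rsmult_one: "x \<in> carrier X \<Longrightarrow> x \<triangleleft> \<one>\<^bsub>L\<^esub> = x"
    and smult_assoc: "\<lbrakk>s \<in> carrier S; x \<in> carrier X; l \<in> carrier L\<rbrakk> \<Longrightarrow>
          (s \<triangleright> x) \<triangleleft> l = s \<triangleright> (x \<triangleleft> l)"

text \<open>A Morita context: \<open>\<phi> x y\<close> is the product \<open>xy \<in> S\<close> and \<open>\<psi> y x\<close> is the product \<open>yx \<in> L\<close>.
  The axioms on \<open>\<phi>\<close> and \<open>\<psi>\<close> say that all products of matrix entries are biadditive and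
  associative.\<close>

locale morita_context = X: bimodule S L X + Y: bimodule L S Y
  for S :: "('s, 'm) ring_scheme" and L :: "('l, 'n) ring_scheme"
    and X :: "('s, 'l, 'x, 'p) bimodule_scheme" and Y :: "('l, 's, 'y, 'q) bimodule_scheme"
    and \<phi> :: "'x \<Rightarrow> 'y \<Rightarrow> 's" and \<psi> :: "'y \<Rightarrow> 'x \<Rightarrow> 'l" +
  assumes phi_closed: "\<lbrakk>x \<in> carrier X; y \<in> carrier Y\<rbrakk> \<Longrightarrow> \<phi> x y \<in> carrier S"
    and psi_closed: "\<lbrakk>y \<in> carrier Y; x \<in> carrier X\<rbrakk> \<Longrightarrow> \<psi> y x \<in> carrier L"
    and phi_l_distr: "\<lbrakk>x \<in> carrier X; x' \<in> carrier X; y \<in> carrier Y\<rbrakk> \<Longrightarrow>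
          \<phi> (x \<oplus>\<^bsub>X\<^esub> x') y = \<phi> x y \<oplus>\<^bsub>S\<^esub> \<phi> x' y"
    and phi_r_distr: "\<lbrakk>x \<in> carrier X; y \<in> carrier Y; y' \<in> carrier Y\<rbrakk> \<Longrightarrow>
          \<phi> x (y \<oplus>\<^bsub>Y\<^esub> y') = \<phi> x y \<oplus>\<^bsub>S\<^esub> \<phi> x y'"
    and psi_l_distr: "\<lbrakk>y \<in> carrier Y; y' \<in> carrier Y; x \<in> carrier X\<rbrakk> \<Longrightarrow>
          \<psi> (y \<oplus>\<^bsub>Y\<^esub> y') x = \<psi> y x \<oplus>\<^bsub>L\<^esub> \<psi> y' x"
    and psi_r_distr: "\<lbrakk>y \<in> carrier Y; x \<in> carrier X; x' \<in> carrier X\<rbrakk> \<Longrightarrow>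
          \<psi> y (x \<oplus>\<^bsub>X\<^esub> x') = \<psi> y x \<oplus>\<^bsub>L\<^esub> \<psi> y x'"
    and phi_lsmult: "\<lbrakk>s \<in> carrier S; x \<in> carrier X; y \<in> carrier Y\<rbrakk> \<Longrightarrow>
          \<phi> (s \<triangleright>\<^bsub>X\<^esub> x) y = s \<otimes>\<^bsub>S\<^esub> \<phi> x y"
    and phi_rsmult: "\<lbrakk>x \<in> carrier X; y \<in> carrier Y; s \<in> carrier S\<rbrakk> \<Longrightarrow>
          \<phi> x (y \<triangleleft>\<^bsub>Y\<^esub> s) = \<phi> x y \<otimes>\<^bsub>S\<^esub> s"
    and phi_balanced: "\<lbrakk>x \<in> carrier X; l \<in> carrier L; y \<in> carrier Y\<rbrakk> \<Longrightarrow>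
          \<phi> (x \<triangleleft>\<^bsub>X\<^esub> l) y = \<phi> x (l \<triangleright>\<^bsub>Y\<^esub> y)"
    and psi_lsmult: "\<lbrakk>l \<in> carrier L; y \<in> carrier Y; x \<in> carrier X\<rbrakk> \<Longrightarrow>
          \<psi> (l \<triangleright>\<^bsub>Y\<^esub> y) x = l \<otimes>\<^bsub>L\<^esub> \<psi> y x"
    and psi_rsmult: "\<lbrakk>y \<in> carrier Y; x \<in> carrier X; l \<in> carrier L\<rbrakk> \<Longrightarrow>
          \<psi> y (x \<triangleleft>\<^bsub>X\<^esub> l) = \<psi> y x \<otimes>\<^bsub>L\<^esub> l"
    and psi_balanced: "\<lbrakk>y \<in> carrier Y; s \<in> carrier S; x \<in> carrier X\<rbrakk> \<Longrightarrow>
          \<psi> (y \<triangleleft>\<^bsub>Y\<^esub> s) x = \<psi> y (s \<triangleright>\<^bsub>X\<^esub> x)"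
    and phi_psi_assoc: "\<lbrakk>x \<in> carrier X; y \<in> carrier Y; x' \<in> carrier X\<rbrakk> \<Longrightarrow>
          \<phi> x y \<triangleright>\<^bsub>X\<^esub> x' = x \<triangleleft>\<^bsub>X\<^esub> \<psi> y x'"
    and psi_phi_assoc: "\<lbrakk>y \<in> carrier Y; x \<in> carrier X; y' \<in> carrier Y\<rbrakk> \<Longrightarrow>
          \<psi> y x \<triangleright>\<^bsub>Y\<^esub> y' = y \<triangleleft>\<^bsub>Y\<^esub> \<phi> x y'"

text \<open>The tuple \<open>(s, x, y, l)\<close> is the matrix with first row \<open>s, x\<close> and second row \<open>y, l\<close>.
  If a ring \<open>R\<close> is isomorphic to such a ring, then the carriers of \<open>S\<close>, \<open>X\<close>, \<open>Y\<close>, \<open>L\<close> embed into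
  that of \<open>R\<close>.  So ``\<open>R\<close> is isomorphic to a generalized matrix ring'', which HOL cannot state by
  quantifying over types, loses nothing by taking all four over the element type of \<open>R\<close> when it is
  a conclusion, while as a hypothesis it may be stated with free type variables.\<close>

definition gen_matrix_ring ::
  "('s, 'm) ring_scheme \<Rightarrow> ('l, 'n) ring_scheme \<Rightarrow>
   ('s, 'l, 'x, 'p) bimodule_scheme \<Rightarrow> ('l, 's, 'y, 'q) bimodule_scheme \<Rightarrow>
   ('x \<Rightarrow> 'y \<Rightarrow> 's) \<Rightarrow> ('y \<Rightarrow> 'x \<Rightarrow> 'l) \<Rightarrow> ('s \<times> 'x \<times> 'y \<times> 'l) ring" where
  "gen_matrix_ring S L X Y \<phi> \<psi> =
    \<lparr>carrier = carrier S \<times> carrier X \<times> carrier Y \<times> carrier L,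
     mult = (\<lambda>(s, x, y, l) (s', x', y', l').
       (s \<otimes>\<^bsub>S\<^esub> s' \<oplus>\<^bsub>S\<^esub> \<phi> x y', s \<triangleright>\<^bsub>X\<^esub> x' \<oplus>\<^bsub>X\<^esub> x \<triangleleft>\<^bsub>X\<^esub> l',
        y \<triangleleft>\<^bsub>Y\<^esub> s' \<oplus>\<^bsub>Y\<^esub> l \<triangleright>\<^bsub>Y\<^esub> y', \<psi> y x' \<oplus>\<^bsub>L\<^esub> l \<otimes>\<^bsub>L\<^esub> l')),
     one = (\<one>\<^bsub>S\<^esub>, \<zero>\<^bsub>X\<^esub>, \<zero>\<^bsub>Y\<^esub>, \<one>\<^bsub>L\<^esub>),
     zero = (\<zero>\<^bsub>S\<^esub>, \<zero>\<^bsub>X\<^esub>, \<zero>\<^bsub>Y\<^esub>, \<zero>\<^bsub>L\<^esub>),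
     add = (\<lambda>(s, x, y, l) (s', x', y', l').
       (s \<oplus>\<^bsub>S\<^esub> s', x \<oplus>\<^bsub>X\<^esub> x', y \<oplus>\<^bsub>Y\<^esub> y', l \<oplus>\<^bsub>L\<^esub> l'))\<rparr>"

text \<open>\<open>XY\<close>, the set of all finite sums of products \<open>xy\<close>.\<close>

definition pairing_sums ::
  "('s, 'm) ring_scheme \<Rightarrow> ('x, 'p) ring_scheme \<Rightarrow> ('y, 'q) ring_scheme \<Rightarrow>
   ('x \<Rightarrow> 'y \<Rightarrow> 's) \<Rightarrow> 's set" where
  "pairing_sums S X Y \<phi> =
    {(\<Oplus>\<^bsub>S\<^esub>i\<in>{..<n}. \<phi> (f i) (g i)) | (n :: nat) f g.
       f \<in> {..<n} \<rightarrow> carrier X \<and> g \<in> {..<n} \<rightarrow> carrier Y}"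

context morita_context
begin

lemmas entry_closed =
  X.S.a_closed X.S.m_closed X.L.a_closed X.L.m_closed X.X.a_closed Y.X.a_closed
  X.lsmult_closed X.rsmult_closed Y.lsmult_closed Y.rsmult_closed phi_closed psi_closed

lemmas entry_distr =
  X.S.l_distr X.S.r_distr X.L.l_distr X.L.r_distr
  X.lsmult_l_distr X.lsmult_r_distr X.rsmult_l_distr X.rsmult_r_distr
  Y.lsmult_l_distr Y.lsmult_r_distr Y.rsmult_l_distr Y.rsmult_r_distr
  phi_l_distr phi_r_distr psi_l_distr psi_r_distr

lemmas entry_assoc =
  X.S.m_assoc X.L.m_assoc
  X.lsmult_assoc X.rsmult_assoc X.smult_assoc Y.lsmult_assoc Y.rsmult_assoc Y.smult_assoc
  phi_lsmult phi_rsmult phi_balanced psi_lsmult psi_rsmult psi_balanced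
  phi_psi_assoc psi_phi_assoc

lemmas entry_ac =
  X.S.a_ac X.L.a_ac X.X.a_ac Y.X.a_ac

lemma lsmult_zero_right: "s \<in> carrier S \<Longrightarrow> s \<triangleright>\<^bsub>X\<^esub> \<zero>\<^bsub>X\<^esub> = \<zero>\<^bsub>X\<^esub>"
  by (metis X.X.zero_closed X.X.l_zero X.X.add.r_cancel_one X.lsmult_closed X.lsmult_r_distr)

lemma lsmult_zero_left: "x \<in> carrier X \<Longrightarrow> \<zero>\<^bsub>S\<^esub> \<triangleright>\<^bsub>X\<^esub> x = \<zero>\<^bsub>X\<^esub>"
  by (metis X.S.zero_closed X.S.l_zero X.X.add.r_cancel_one X.lsmult_closed X.lsmult_l_distr)

lemma rsmult_zero_right: "x \<in> carrier X \<Longrightarrow> x \<triangleleft>\<^bsub>X\<^esub> \<zero>\<^bsub>L\<^esub> = \<zero>\<^bsub>X\<^esub>"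
  by (metis X.L.zero_closed X.L.l_zero X.X.add.r_cancel_one X.rsmult_closed X.rsmult_r_distr)

lemma rsmult_zero_left: "l \<in> carrier L \<Longrightarrow> \<zero>\<^bsub>X\<^esub> \<triangleleft>\<^bsub>X\<^esub> l = \<zero>\<^bsub>X\<^esub>"
  by (metis X.X.zero_closed X.X.l_zero X.X.add.r_cancel_one X.rsmult_closed X.rsmult_l_distr)

lemma phi_zero_left: "y \<in> carrier Y \<Longrightarrow> \<phi> \<zero>\<^bsub>X\<^esub> y = \<zero>\<^bsub>S\<^esub>"
  by (metis X.X.zero_closed X.X.l_zero X.S.add.r_cancel_one phi_closed phi_l_distr)

lemma phi_zero_right: "x \<in> carrier X \<Longrightarrow> \<phi> x \<zero>\<^bsub>Y\<^esub> = \<zero>\<^bsub>S\<^esub>"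
  by (metis Y.X.zero_closed Y.X.l_zero X.S.add.r_cancel_one phi_closed phi_r_distr)

lemma morita_context_swap: "morita_context L S Y X \<psi> \<phi>"
  by (intro morita_context.intro Y.bimodule_axioms X.bimodule_axioms morita_context_axioms.intro)
    (simp_all add: entry_closed entry_distr entry_assoc)

end

context morita_context
begin

interpretation swap: morita_context L S Y X \<psi> \<phi>
  by (rule morita_context_swap)

lemmas entry_zero =
  lsmult_zero_right lsmult_zero_left rsmult_zero_right rsmult_zero_left phi_zero_left phi_zero_right
  swap.lsmult_zero_right swap.lsmult_zero_left swap.rsmult_zero_right swap.rsmult_zero_left
  swap.phi_zero_left swap.phi_zero_right

lemma gen_matrix_ring_is_ring: "ring (gen_matrix_ring S L X Y \<phi> \<psi>)"
proof (rule ringI)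
  show "abelian_group (gen_matrix_ring S L X Y \<phi> \<psi>)"
  proof (rule abelian_groupI)
    fix a assume "a \<in> carrier (gen_matrix_ring S L X Y \<phi> \<psi>)"
    then obtain s x y l where a: "a = (s, x, y, l)"
      and m: "s \<in> carrier S" "x \<in> carrier X" "y \<in> carrier Y" "l \<in> carrier L"
      by (auto simp: gen_matrix_ring_def)
    show "\<exists>b \<in> carrier (gen_matrix_ring S L X Y \<phi> \<psi>).
        b \<oplus>\<^bsub>gen_matrix_ring S L X Y \<phi> \<psi>\<^esub> a = \<zero>\<^bsub>gen_matrix_ring S L X Y \<phi> \<psi>\<^esub>"
      using m
      by (intro bexI[of _ "(\<ominus>\<^bsub>S\<^esub> s, \<ominus>\<^bsub>X\<^esub> x, \<ominus>\<^bsub>Y\<^esub> y, \<ominus>\<^bsub>L\<^esub> l)"])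
        (auto simp: gen_matrix_ring_def a X.S.l_neg X.L.l_neg X.X.l_neg Y.X.l_neg)
  qed (auto simp: gen_matrix_ring_def entry_ac entry_closed)
  show "monoid (gen_matrix_ring S L X Y \<phi> \<psi>)"
    by (rule monoidI)
      (auto simp: gen_matrix_ring_def entry_closed entry_distr entry_assoc entry_ac entry_zero
        X.lsmult_one X.rsmult_one Y.lsmult_one Y.rsmult_one)
qed (auto simp: gen_matrix_ring_def entry_closed entry_distr entry_ac)

end

end

theory Submission
  imports Defs
begin

text \<open>Let \<open>R\<close> be VNL and \<open>f = 1 - e\<close>.  Regular elements of \<open>eRe\<close> are zero or
  units because \<open>e\<close> is primitive, so \<open>eRe\<close> is local, and it contains an element \<open>a\<close> that
  is not regular.  For \<open>s \<in> fRf\<close> the element \<open>a + (f - s)\<close> is not regular, hence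
  \<open>(e - a) + s\<close> is, and so is \<open>s\<close>.  A nonzero product of \<open>fRe\<close> and \<open>eRf\<close> would
  embed \<open>eRe\<close> into the regular ring \<open>fRf\<close> as a corner, making \<open>a\<close> regular.
  Conversely, a matrix whose lower right entry is a unit is equivalent to a diagonal one, which is
  regular; and of \<open>l\<close>, \<open>1 - l\<close> in a local ring one is a unit.\<close>

section \<open>Local rings\<close>

context ring
begin

lemma left_ideal_eq_carrier:
  assumes "left_ideal I R" and "\<one> \<in> I"
  shows "I = carrier R"
proof
  show "I \<subseteq> carrier R"
    using assms(1) additive_subgroup.a_subset unfolding left_ideal_def by blast
  show "carrier R \<subseteq> I"
  proof
    fix r assume "r \<in> carrier R"
    then show "r \<in> I" using assms unfolding left_ideal_def by (metis r_one)
  qed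
qed

lemma left_ideal_with_left_invertible:
  assumes "left_ideal I R" and "a \<in> I" and "b \<in> carrier R" and "b \<otimes> a = \<one>"
  shows "I = carrier R"
proof (rule left_ideal_eq_carrier)
  have "b \<otimes> a \<in> I" using assms(1-3) unfolding left_ideal_def by blast
  then show "\<one> \<in> I" using assms(4) by simp
qed fact

text \<open>Negatives come from left multiplication by \<open>\<ominus> \<one>\<close>, so zero,
  sums and left multiples are all that has to be checked.\<close>

lemma left_idealI:
  assumes "I \<subseteq> carrier R" and "\<zero> \<in> I"
    and "\<And>a b. a \<in> I \<Longrightarrow> b \<in> I \<Longrightarrow> a \<oplus> b \<in> I"
    and "\<And>r a. r \<in> carrier R \<Longrightarrow> a \<in> I \<Longrightarrow> r \<otimes> a \<in> I"
  shows "left_ideal I R"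
proof -
  have "\<ominus> a \<in> I" if "a \<in> I" for a
  proof -
    have "\<ominus> a = (\<ominus> \<one>) \<otimes> a" using that assms(1) by (metis l_minus l_one one_closed subsetD)
    then show ?thesis using assms(4) that by simp
  qed
  then have "subgroup I (add_monoid R)"
    using assms by (intro add.subgroupI) (auto simp: a_inv_def)
  then show ?thesis
    using assms(4) unfolding left_ideal_def by (auto intro: additive_subgroup.intro)
qed

lemma principal_left_ideal:
  assumes "a \<in> carrier R"
  shows "left_ideal {r \<otimes> a | r. r \<in> carrier R} R"
proof (rule left_idealI)
  show "{r \<otimes> a | r. r \<in> carrier R} \<subseteq> carrier R" using assms by auto
  show "\<zero> \<in> {r \<otimes> a | r. r \<in> carrier R}" using assms by (auto intro!: exI[of _ \<zero>])
next
  fix b c assume "b \<in> {r \<otimes> a | r. r \<in> carrier R}" "c \<in> {r \<otimes> a | r. r \<in> carrier R}"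
  then show "b \<oplus> c \<in> {r \<otimes> a | r. r \<in> carrier R}"
    using assms by (auto simp flip: l_distr)
next
  fix s b assume "s \<in> carrier R" "b \<in> {r \<otimes> a | r. r \<in> carrier R}"
  then show "s \<otimes> b \<in> {r \<otimes> a | r. r \<in> carrier R}"
    using assms by (auto simp flip: m_assoc)
qed

text \<open>Zorn's lemma on the left ideals above \<open>I\<close> that miss \<open>\<one>\<close>.
  For left ideals, missing \<open>\<one>\<close> is the same as being proper, and it visibly passes
  to unions of chains.\<close>

lemma exists_maximal_left_ideal:
  assumes "left_ideal I R" and "\<one> \<notin> I"
  obtains M where "maximal_left_ideal M R" and "I \<subseteq> M"
proof -
  define A where "A = {J. left_ideal J R \<and> I \<subseteq> J \<and> \<one> \<notin> J}"
  have "\<exists>M\<in>A. \<forall>J\<in>A. M \<subseteq> J \<longrightarrow> J = M"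
  proof (rule subset_Zorn_nonempty)
    show "A \<noteq> {}" using assms unfolding A_def by auto
  next
    fix C assume C: "C \<noteq> {}" "subset.chain A C"
    have mem: "left_ideal J R" "I \<subseteq> J" "\<one> \<notin> J" if "J \<in> C" for J
      using C(2) that unfolding A_def subset_chain_def by auto
    have ag: "additive_subgroup J R" if "J \<in> C" for J
      using mem(1)[OF that] unfolding left_ideal_def by simp
    have "left_ideal (\<Union>C) R"
    proof (rule left_idealI)
      show "\<Union>C \<subseteq> carrier R" using additive_subgroup.a_subset[OF ag] by auto
      show "\<zero> \<in> \<Union>C" using C(1) additive_subgroup.zero_closed[OF ag] by auto
    next
      fix a b assume "a \<in> \<Union>C" "b \<in> \<Union>C"
      then obtain J K where JK: "J \<in> C" "K \<in> C" "a \<in> J" "b \<in> K" by auto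
      then have "J \<subseteq> K \<or> K \<subseteq> J" using C(2) unfolding subset_chain_def by auto
      then obtain N where "N \<in> C" "a \<in> N" "b \<in> N" using JK by blast
      then show "a \<oplus> b \<in> \<Union>C" using additive_subgroup.a_closed[OF ag] by auto
    next
      fix r a assume "r \<in> carrier R" "a \<in> \<Union>C"
      then show "r \<otimes> a \<in> \<Union>C" using mem(1) unfolding left_ideal_def by blast
    qed
    then show "\<Union>C \<in> A" using mem C(1) unfolding A_def by blast
  qed
  then obtain M where M: "M \<in> A" "\<And>J. J \<in> A \<Longrightarrow> M \<subseteq> J \<Longrightarrow> J = M" by blast
  have "maximal_left_ideal M R"
    unfolding maximal_left_ideal_def
  proof (intro conjI allI impI)
    show "left_ideal M R" using M(1) unfolding A_def by simp
    show "M \<noteq> carrier R" using M(1) unfolding A_def by auto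
    fix J assume J: "left_ideal J R \<and> M \<subseteq> J"
    show "J = M \<or> J = carrier R"
    proof (cases "\<one> \<in> J")
      case True
      then show ?thesis using J left_ideal_eq_carrier by blast
    next
      case False
      then have "J \<in> A" using J M(1) unfolding A_def by auto
      then show ?thesis using M(2) J by blast
    qed
  qed
  then show thesis using that M(1) unfolding A_def by blast
qed

text \<open>Let \<open>M\<close> be the unique maximal left ideal. An element outside
  \<open>M\<close> has a left inverse, since otherwise it would generate a proper left ideal, which
  lies in \<open>M\<close>. These left inverses turn out to be two-sided, and \<open>a\<close> and
  \<open>\<one> \<ominus> a\<close> cannot both lie in \<open>M\<close>.\<close>

lemma local_ringD:
  assumes "local_ring R" and a: "a \<in> carrier R"
  shows "a \<in> Units R \<or> \<one> \<ominus> a \<in> Units R"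
proof -
  obtain M where M: "maximal_left_ideal M R"
    and uniq: "\<And>N. maximal_left_ideal N R \<Longrightarrow> N = M"
    using assms(1) unfolding local_ring_def by blast
  have ideal: "left_ideal M R" and "M \<noteq> carrier R"
    using M unfolding maximal_left_ideal_def by auto
  then have one: "\<one> \<notin> M" using left_ideal_eq_carrier by blast
  have ag: "additive_subgroup M R" using ideal unfolding left_ideal_def by simp
  have left_inv: "\<exists>c \<in> carrier R. c \<otimes> b = \<one>" if b: "b \<in> carrier R" "b \<notin> M" for b
  proof (rule ccontr)
    assume no: "\<not> ?thesis"
    have "\<one> \<notin> {r \<otimes> b | r. r \<in> carrier R}"
    proof
      assume "\<one> \<in> {r \<otimes> b | r. r \<in> carrier R}"
      then obtain r where "r \<in> carrier R" "\<one> = r \<otimes> b" by blast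
      then show False using no by auto
    qed
    then obtain N where "maximal_left_ideal N R" "{r \<otimes> b | r. r \<in> carrier R} \<subseteq> N"
      using exists_maximal_left_ideal[OF principal_left_ideal[OF b(1)]] by blast
    moreover have "b \<in> {r \<otimes> b | r. r \<in> carrier R}"
      using b(1) by (auto intro!: exI[of _ \<one>])
    ultimately show False using uniq b(2) by blast
  qed
  have unit: "b \<in> Units R" if b: "b \<in> carrier R" "b \<notin> M" for b
  proof -
    obtain c where c: "c \<in> carrier R" "c \<otimes> b = \<one>" using left_inv b by blast
    \<comment> \<open>If \<open>c\<close> were in \<open>M\<close>, then so would be
      \<open>b \<otimes> c\<close>, and \<open>\<one> \<ominus> b \<otimes> c\<close> would have a
      left inverse. But it annihilates \<open>b\<close> from the left, because
      \<open>c \<otimes> b = \<one>\<close>; so \<open>b\<close> would be zero and lie in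
      \<open>M\<close>.\<close>
    have "c \<notin> M"
    proof
      assume "c \<in> M"
      then have bc: "b \<otimes> c \<in> M" using ideal b(1) unfolding left_ideal_def by blast
      have "\<one> \<ominus> b \<otimes> c \<notin> M"
      proof
        assume "\<one> \<ominus> b \<otimes> c \<in> M"
        then have "(\<one> \<ominus> b \<otimes> c) \<oplus> b \<otimes> c \<in> M" using additive_subgroup.a_closed[OF ag] bc by blast
        moreover have "(\<one> \<ominus> b \<otimes> c) \<oplus> b \<otimes> c = \<one>" using b c by algebra
        ultimately show False using one by simp
      qed
      then obtain d where d: "d \<in> carrier R" "d \<otimes> (\<one> \<ominus> b \<otimes> c) = \<one>"
        using left_inv b c by (meson m_closed minus_closed one_closed)
      have "b = (d \<otimes> (\<one> \<ominus> b \<otimes> c)) \<otimes> b" using d b by simp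
      also have "\<dots> = d \<otimes> (b \<ominus> b \<otimes> (c \<otimes> b))"
        using b c(1) d(1) by (simp add: m_assoc minus_eq l_distr l_minus)
      also have "\<dots> = \<zero>" using b d(1) c by (simp add: minus_eq r_neg)
      finally show False using b additive_subgroup.zero_closed[OF ag] by simp
    qed
    then obtain d where d: "d \<in> carrier R" "d \<otimes> c = \<one>" using left_inv c by blast
    \<comment> \<open>\<open>d\<close> is a left and \<open>b\<close> a right inverse of
      \<open>c\<close>, so they agree.\<close>
    then have "d = b" using b c by (metis l_one m_assoc r_one)
    then show ?thesis using b c d unfolding Units_def by blast
  qed
  have "\<one> \<ominus> a \<notin> M" if "a \<in> M"
  proof
    assume "\<one> \<ominus> a \<in> M"
    then have "(\<one> \<ominus> a) \<oplus> a \<in> M" using additive_subgroup.a_closed[OF ag] that by blast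
    moreover have "(\<one> \<ominus> a) \<oplus> a = \<one>" using a by algebra
    ultimately show False using one by simp
  qed
  then show ?thesis using unit a by (metis minus_closed one_closed)
qed

text \<open>The dichotomy first makes one-sided inverses two-sided. Then the nonunits form a left
  ideal, and this ideal contains every proper left ideal.\<close>

lemma local_ringI:
  assumes "\<one> \<noteq> \<zero>"
    and dich: "\<And>a. a \<in> carrier R \<Longrightarrow> a \<in> Units R \<or> \<one> \<ominus> a \<in> Units R"
  shows "local_ring R"
proof -
  have one_sided: "a \<in> Units R \<and> b \<in> Units R"
    if ab: "a \<in> carrier R" "b \<in> carrier R" "b \<otimes> a = \<one>" for a b
  proof -
    \<comment> \<open>\<open>a \<otimes> b\<close> is idempotent, hence \<open>\<one>\<close> if it
      is a unit. If its complement is a unit instead,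
      \<open>(\<one> \<ominus> a \<otimes> b) \<otimes> a = \<zero>\<close> forces
      \<open>a = \<zero>\<close>, against \<open>b \<otimes> a = \<one>\<close>.\<close>
    have "a \<otimes> b = \<one>"
      using dich[of "a \<otimes> b"]
    proof
      assume u: "a \<otimes> b \<in> Units R"
      have "(a \<otimes> b) \<otimes> (a \<otimes> b) = (a \<otimes> b) \<otimes> \<one>"
        using ab by (metis m_assoc m_closed r_one)
      then show ?thesis using u by (metis Units_l_cancel ab(1,2) m_closed one_closed)
    next
      assume u: "\<one> \<ominus> a \<otimes> b \<in> Units R"
      have "(\<one> \<ominus> a \<otimes> b) \<otimes> a = a \<ominus> a \<otimes> (b \<otimes> a)"
        using ab(1,2) by (simp add: m_assoc minus_eq l_distr l_minus)
      also have "\<dots> = \<zero>" using ab by (simp add: minus_eq r_neg)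
      also have "\<dots> = (\<one> \<ominus> a \<otimes> b) \<otimes> \<zero>" using ab by simp
      finally have "a = \<zero>" using u by (metis Units_l_cancel ab(1) zero_closed)
      then show ?thesis using ab assms(1) by simp
    qed (use ab in simp)
    then show ?thesis using ab unfolding Units_def by blast
  qed
  have factor: "a \<in> Units R" if ab: "a \<in> carrier R" "b \<in> carrier R" "b \<otimes> a \<in> Units R" for a b
  proof -
    obtain c where "c \<in> carrier R" "c \<otimes> (b \<otimes> a) = \<one>" using ab(3) unfolding Units_def by blast
    then show ?thesis using one_sided[of a "c \<otimes> b"] ab(1,2) by (simp add: m_assoc)
  qed
  define I where "I = carrier R - Units R"
  have ideal: "left_ideal I R"
  proof (rule left_idealI)
    show "I \<subseteq> carrier R" unfolding I_def by auto
    show "\<zero> \<in> I" using assms(1) unfolding I_def Units_def by auto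
  next
    fix a b assume "a \<in> I" "b \<in> I"
    then have ab: "a \<in> carrier R" "b \<in> carrier R" "a \<notin> Units R" "b \<notin> Units R"
      unfolding I_def by auto
    \<comment> \<open>Scaling by a left inverse of the sum gives two multiples of \<open>a\<close>
      and \<open>b\<close> that add up to \<open>\<one>\<close>; one of them is a unit, and
      \<open>factor\<close> passes this on to \<open>a\<close> or \<open>b\<close>.\<close>
    have "a \<oplus> b \<notin> Units R"
    proof
      assume "a \<oplus> b \<in> Units R"
      then obtain c where c: "c \<in> carrier R" "c \<otimes> (a \<oplus> b) = \<one>" unfolding Units_def by blast
      have "\<one> \<ominus> c \<otimes> a = (c \<otimes> a \<oplus> c \<otimes> b) \<ominus> c \<otimes> a"
        using c ab(1,2) by (simp add: r_distr)
      also have "\<dots> = c \<otimes> b" using ab(1,2) c(1) by algebra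
      finally have "\<one> \<ominus> c \<otimes> a = c \<otimes> b" .
      then have "c \<otimes> a \<in> Units R \<or> c \<otimes> b \<in> Units R" using dich[of "c \<otimes> a"] ab c by simp
      then show False using factor ab c by blast
    qed
    then show "a \<oplus> b \<in> I" using ab unfolding I_def by simp
  next
    fix r a assume "r \<in> carrier R" "a \<in> I"
    then show "r \<otimes> a \<in> I" using factor[of a r] unfolding I_def by auto
  qed
  \<comment> \<open>This one inclusion yields both the maximality of \<open>I\<close> and its
    uniqueness.\<close>
  have proper: "J \<subseteq> I" if "left_ideal J R" "J \<noteq> carrier R" for J
  proof
    fix a assume a: "a \<in> J"
    then have "a \<in> carrier R"
      using that(1) additive_subgroup.a_subset unfolding left_ideal_def by blast
    moreover have "a \<notin> Units R"
      using left_ideal_with_left_invertible[OF that(1) a] that(2) unfolding Units_def by blast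
    ultimately show "a \<in> I" unfolding I_def by simp
  qed
  have I_proper: "I \<noteq> carrier R" unfolding I_def by auto
  have "maximal_left_ideal I R"
    using ideal I_proper proper unfolding maximal_left_ideal_def by blast
  moreover have "J = I" if "maximal_left_ideal J R" for J
    using that ideal I_proper proper unfolding maximal_left_ideal_def by blast
  ultimately show ?thesis unfolding local_ring_def using ring_axioms by blast
qed

end

section \<open>Regular elements\<close>

lemma vn_regularI: "\<lbrakk>a \<in> carrier R; b \<in> carrier R; a \<otimes>\<^bsub>R\<^esub> b \<otimes>\<^bsub>R\<^esub> a = a\<rbrakk> \<Longrightarrow> vn_regular R a"
  unfolding vn_regular_def by metis

context ring
begin

text \<open>An inner inverse \<open>b\<close> of \<open>d\<close> is transported to
  \<open>inv q \<otimes> b \<otimes> inv p\<close>. Regularity is therefore invariant under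
  invertible row and column operations.\<close>

lemma vn_regular_unit_mult:
  assumes p: "p \<in> Units R" and q: "q \<in> Units R" and d: "vn_regular R d"
  shows "vn_regular R (p \<otimes> d \<otimes> q)"
proof -
  obtain b where b: "b \<in> carrier R" "d \<otimes> b \<otimes> d = d" and dc: "d \<in> carrier R"
    using d unfolding vn_regular_def by metis
  have c: "p \<in> carrier R" "q \<in> carrier R" "inv p \<in> carrier R" "inv q \<in> carrier R"
    using p q by auto
  define z where "z = inv q \<otimes> b \<otimes> inv p"
  have "(p \<otimes> d \<otimes> q) \<otimes> z \<otimes> (p \<otimes> d \<otimes> q)
      = p \<otimes> (d \<otimes> ((q \<otimes> inv q) \<otimes> b \<otimes> (inv p \<otimes> p)) \<otimes> d) \<otimes> q"
    unfolding z_def using c b(1) dc by (simp only: m_assoc m_closed)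
  also have "\<dots> = p \<otimes> d \<otimes> q" using p q b by simp
  finally show ?thesis
    unfolding vn_regular_def using c b(1) dc z_def by (metis m_closed)
qed

text \<open>An inner inverse of \<open>u\<close> also serves for \<open>g \<otimes> u\<close>,
  because \<open>g\<close> can be moved to the outside. This compresses the regularity of a block
  diagonal element to one of its blocks.\<close>

lemma vn_regular_commuting_idempotent:
  assumes g: "idempotent_elem R g" and u: "vn_regular R u" and comm: "g \<otimes> u = u \<otimes> g"
  shows "vn_regular R (g \<otimes> u)"
proof -
  obtain b where b: "b \<in> carrier R" "u = u \<otimes> b \<otimes> u" and uc: "u \<in> carrier R"
    using u unfolding vn_regular_def by blast
  have gc: "g \<in> carrier R" "g \<otimes> g = g" using g unfolding idempotent_elem_def by auto
  have "(g \<otimes> u) \<otimes> b \<otimes> (g \<otimes> u) = g \<otimes> (u \<otimes> b \<otimes> u) \<otimes> g"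
    unfolding comm using gc b(1) uc comm by (metis m_assoc m_closed)
  also have "\<dots> = g \<otimes> g \<otimes> u" using b gc uc comm by (metis m_assoc)
  finally show ?thesis using gc b(1) uc by (intro vn_regularI[where b = b]) simp_all
qed

end

lemma vn_regular_ring_iso:
  assumes "ring R" and h: "h \<in> ring_iso R M" and a: "a \<in> carrier R"
    and reg: "vn_regular M (h a)"
  shows "vn_regular R a"
proof -
  interpret R: ring R by fact
  have hom: "h \<in> ring_hom R M" and bij: "bij_betw h (carrier R) (carrier M)"
    using h unfolding ring_iso_def by auto
  obtain c where c: "c \<in> carrier M" "h a = h a \<otimes>\<^bsub>M\<^esub> c \<otimes>\<^bsub>M\<^esub> h a"
    using reg unfolding vn_regular_def by blast
  obtain b where b: "b \<in> carrier R" "h b = c"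
    using bij c(1) by (metis bij_betw_imp_surj_on imageE)
  have "h (a \<otimes>\<^bsub>R\<^esub> b \<otimes>\<^bsub>R\<^esub> a) = h a"
    using a b c(2) ring_hom_mult[OF hom] by simp
  then have "a \<otimes>\<^bsub>R\<^esub> b \<otimes>\<^bsub>R\<^esub> a = a"
    using bij a b by (metis bij_betw_imp_inj_on inj_onD R.m_closed)
  then show ?thesis using a b unfolding vn_regular_def by metis
qed

lemma VNL_ring_iso:
  assumes "ring R" and "VNL_ring M" and "R \<simeq> M"
  shows "VNL_ring R"
proof -
  obtain h where h: "h \<in> ring_iso R M" using assms(3) unfolding is_ring_iso_def by blast
  interpret R: ring R by fact
  interpret M: ring M using assms(2) unfolding VNL_ring_def by simp
  interpret ring_hom_ring R M h
    using h by (intro ring_hom_ringI2 R.ring_axioms M.ring_axioms) (simp add: ring_iso_def)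
  have "vn_regular R a \<or> vn_regular R (\<one>\<^bsub>R\<^esub> \<ominus>\<^bsub>R\<^esub> a)" if "a \<in> carrier R" for a
  proof -
    have "h (\<one>\<^bsub>R\<^esub> \<ominus>\<^bsub>R\<^esub> a) = \<one>\<^bsub>M\<^esub> \<ominus>\<^bsub>M\<^esub> h a"
      using that by (simp add: R.minus_eq M.minus_eq)
    then show ?thesis
      using assms(2) that vn_regular_ring_iso[OF assms(1) h] unfolding VNL_ring_def
      by (metis hom_closed R.minus_closed R.one_closed)
  qed
  then show ?thesis using assms(1) unfolding VNL_ring_def by blast
qed

section \<open>Generalized matrix rings over a regular and a local ring\<close>

lemma UnitsI:
  "\<lbrakk>a \<in> carrier R; b \<in> carrier R; a \<otimes>\<^bsub>R\<^esub> b = \<one>\<^bsub>R\<^esub>; b \<otimes>\<^bsub>R\<^esub> a = \<one>\<^bsub>R\<^esub>\<rbrakk> \<Longrightarrow> a \<in> Units R"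
  unfolding Units_def by blast

context morita_context
begin

text \<open>With \<open>k = l\<inverse>\<close>, row and column operations factor the matrix through
  the diagonal matrix with entries \<open>s - x k y\<close> and \<open>l\<close>.\<close>

lemma vn_regular_gen_matrix:
  assumes S: "regular_ring S" and l: "l \<in> Units L"
    and s: "s \<in> carrier S" and x: "x \<in> carrier X" and y: "y \<in> carrier Y"
  shows "vn_regular (gen_matrix_ring S L X Y \<phi> \<psi>) (s, x, y, l)" (is "vn_regular ?M _")
proof -
  interpret M: ring ?M by (rule gen_matrix_ring_is_ring)
  have lc: "l \<in> carrier L" using l by auto
  obtain k where k: "k \<in> carrier L" "k \<otimes>\<^bsub>L\<^esub> l = \<one>\<^bsub>L\<^esub>" "l \<otimes>\<^bsub>L\<^esub> k = \<one>\<^bsub>L\<^esub>"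
    using l unfolding Units_def by blast
  define x' where "x' = x \<triangleleft>\<^bsub>X\<^esub> k"
  define y' where "y' = k \<triangleright>\<^bsub>Y\<^esub> y"
  define d where "d = s \<ominus>\<^bsub>S\<^esub> \<phi> x y'"
  have xy: "x' \<in> carrier X" "y' \<in> carrier Y" unfolding x'_def y'_def
    using x y k by (auto simp: entry_closed)
  have x'l: "x' \<triangleleft>\<^bsub>X\<^esub> l = x" unfolding x'_def using x k lc
    by (simp add: X.rsmult_one flip: X.rsmult_assoc)
  have ly': "l \<triangleright>\<^bsub>Y\<^esub> y' = y" unfolding y'_def using y k lc
    by (simp add: Y.lsmult_one flip: Y.lsmult_assoc)
  have phi: "\<phi> x y' \<in> carrier S" using x xy by (simp add: phi_closed)
  have d: "d \<in> carrier S" unfolding d_def using s phi by simp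
  then obtain t where t: "t \<in> carrier S" "d \<otimes>\<^bsub>S\<^esub> t \<otimes>\<^bsub>S\<^esub> d = d"
    using S unfolding regular_ring_def vn_regular_def by metis
  have ds: "d \<oplus>\<^bsub>S\<^esub> \<phi> x y' = s"
    unfolding d_def using s phi by (simp add: X.S.minus_eq X.S.a_assoc X.S.l_neg)
  note simps = gen_matrix_ring_def entry_closed entry_zero
    X.lsmult_one X.rsmult_one Y.lsmult_one Y.rsmult_one
  \<comment> \<open>Elementary matrices are inverted by negating the off-diagonal entry.\<close>
  have P: "(\<one>\<^bsub>S\<^esub>, x', \<zero>\<^bsub>Y\<^esub>, \<one>\<^bsub>L\<^esub>) \<in> Units ?M"
    using xy by (intro UnitsI[where b = "(\<one>\<^bsub>S\<^esub>, \<ominus>\<^bsub>X\<^esub> x', \<zero>\<^bsub>Y\<^esub>, \<one>\<^bsub>L\<^esub>)"])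
      (simp_all add: simps X.X.l_neg X.X.r_neg)
  have Q: "(\<one>\<^bsub>S\<^esub>, \<zero>\<^bsub>X\<^esub>, y', \<one>\<^bsub>L\<^esub>) \<in> Units ?M"
    using xy by (intro UnitsI[where b = "(\<one>\<^bsub>S\<^esub>, \<zero>\<^bsub>X\<^esub>, \<ominus>\<^bsub>Y\<^esub> y', \<one>\<^bsub>L\<^esub>)"])
      (simp_all add: simps Y.X.l_neg Y.X.r_neg)
  have D: "vn_regular ?M (d, \<zero>\<^bsub>X\<^esub>, \<zero>\<^bsub>Y\<^esub>, l)"
    using d t k lc by (intro vn_regularI[where b = "(t, \<zero>\<^bsub>X\<^esub>, \<zero>\<^bsub>Y\<^esub>, k)"]) (simp_all add: simps)
  have "(\<one>\<^bsub>S\<^esub>, x', \<zero>\<^bsub>Y\<^esub>, \<one>\<^bsub>L\<^esub>) \<otimes>\<^bsub>?M\<^esub> (d, \<zero>\<^bsub>X\<^esub>, \<zero>\<^bsub>Y\<^esub>, l) \<otimes>\<^bsub>?M\<^esub> (\<one>\<^bsub>S\<^esub>, \<zero>\<^bsub>X\<^esub>, y', \<one>\<^bsub>L\<^esub>) = (s, x, y, l)"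
    using d lc x xy y by (simp add: simps x'l ly' ds)
  then show ?thesis using M.vn_regular_unit_mult[OF P Q D] by simp
qed

lemma VNL_gen_matrix_ring:
  assumes "regular_ring S" and "local_ring L"
  shows "VNL_ring (gen_matrix_ring S L X Y \<phi> \<psi>)" (is "VNL_ring ?M")
  unfolding VNL_ring_def
proof (intro conjI ballI)
  interpret M: ring ?M by (rule gen_matrix_ring_is_ring)
  show "ring ?M" by (rule M.ring_axioms)
  fix a assume a: "a \<in> carrier ?M"
  obtain s x y l where a_eq: "a = (s, x, y, l)" by (cases a)
  obtain s' x' y' l' where a'_eq: "\<one>\<^bsub>?M\<^esub> \<ominus>\<^bsub>?M\<^esub> a = (s', x', y', l')"
    by (cases "\<one>\<^bsub>?M\<^esub> \<ominus>\<^bsub>?M\<^esub> a")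
  have a': "\<one>\<^bsub>?M\<^esub> \<ominus>\<^bsub>?M\<^esub> a \<in> carrier ?M" using a by simp
  \<comment> \<open>Negation in the matrix ring is not given entrywise by its definition, so the
    lower right entry of the difference is read off from an equation that uses only
    addition.\<close>
  have "(\<one>\<^bsub>?M\<^esub> \<ominus>\<^bsub>?M\<^esub> a) \<oplus>\<^bsub>?M\<^esub> a = \<one>\<^bsub>?M\<^esub>"
    using a by (simp add: M.minus_eq M.a_assoc M.l_neg)
  then have "(s', x', y', l') \<oplus>\<^bsub>?M\<^esub> (s, x, y, l) = \<one>\<^bsub>?M\<^esub>"
    by (simp only: a'_eq flip: a_eq)
  then have sum: "l' \<oplus>\<^bsub>L\<^esub> l = \<one>\<^bsub>L\<^esub>" by (simp add: gen_matrix_ring_def)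
  have c: "s \<in> carrier S" "x \<in> carrier X" "y \<in> carrier Y" "l \<in> carrier L"
    "s' \<in> carrier S" "x' \<in> carrier X" "y' \<in> carrier Y" "l' \<in> carrier L"
    using a[unfolded a_eq] a'[unfolded a'_eq] by (simp_all add: gen_matrix_ring_def)
  have "\<one>\<^bsub>L\<^esub> \<ominus>\<^bsub>L\<^esub> l = l'"
    using c sum by (metis X.L.minus_eq X.L.a_assoc X.L.r_neg X.L.r_zero X.L.a_inv_closed)
  then have "l \<in> Units L \<or> l' \<in> Units L" using X.L.local_ringD[OF assms(2), of l] c by simp
  then show "vn_regular ?M a \<or> vn_regular ?M (\<one>\<^bsub>?M\<^esub> \<ominus>\<^bsub>?M\<^esub> a)"
    unfolding a'_eq unfolding a_eq using vn_regular_gen_matrix[OF assms(1)] c by blast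
qed

end

section \<open>Peirce decomposition\<close>

text \<open>For idempotents this is \<open>gRh\<close>. Fixed-point equations make membership usable
  for rewriting, without witnesses.\<close>

definition peirce :: "('a, 'm) ring_scheme \<Rightarrow> 'a \<Rightarrow> 'a \<Rightarrow> 'a set" where
  "peirce R g h = {x \<in> carrier R. g \<otimes>\<^bsub>R\<^esub> x = x \<and> x \<otimes>\<^bsub>R\<^esub> h = x}"

text \<open>\<open>corner R g\<close> keeps the record extension of \<open>R\<close>; this copy has
  the plain type \<open>'a ring\<close> that the final statement asks for.\<close>

definition peirce_ring :: "('a, 'm) ring_scheme \<Rightarrow> 'a \<Rightarrow> 'a ring" where
  "peirce_ring R g =
    \<lparr>carrier = peirce R g g, mult = mult R, one = g, zero = \<zero>\<^bsub>R\<^esub>, add = add R\<rparr>"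

definition peirce_bimodule :: "('a, 'm) ring_scheme \<Rightarrow> 'a \<Rightarrow> 'a \<Rightarrow> ('a, 'a, 'a) bimodule" where
  "peirce_bimodule R g h =
    \<lparr>carrier = peirce R g h, mult = mult R, one = \<one>\<^bsub>R\<^esub>, zero = \<zero>\<^bsub>R\<^esub>, add = add R,
     lsmult = mult R, rsmult = mult R\<rparr>"

context ring
begin

lemma peirceD:
  assumes "x \<in> peirce R g h"
  shows "x \<in> carrier R" "g \<otimes> x = x" "x \<otimes> h = x"
  using assms unfolding peirce_def by auto

lemma idempotent_elemD:
  assumes "idempotent_elem R g"
  shows "g \<in> carrier R" "g \<otimes> g = g"
  using assms unfolding idempotent_elem_def by auto

lemma peirce_idempotent: "idempotent_elem R g \<Longrightarrow> g \<in> peirce R g g"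
  unfolding idempotent_elem_def peirce_def by simp

lemma peirce_mult:
  assumes "idempotent_elem R g" "idempotent_elem R h" "x \<in> carrier R"
  shows "g \<otimes> x \<otimes> h \<in> peirce R g h"
  using assms unfolding idempotent_elem_def peirce_def by (auto simp: m_assoc) (simp flip: m_assoc)

lemma carrier_corner:
  assumes "idempotent_elem R g"
  shows "carrier (corner R g) = peirce R g g"
  using peirce_mult[OF assms assms] unfolding corner_def by (force simp: peirce_def)

lemma peirce_zero:
  assumes "g \<in> carrier R" "h \<in> carrier R"
  shows "\<zero> \<in> peirce R g h"
  using assms unfolding peirce_def by simp

lemma peirce_add:
  assumes "g \<in> carrier R" "h \<in> carrier R" "x \<in> peirce R g h" "y \<in> peirce R g h"
  shows "x \<oplus> y \<in> peirce R g h"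
  using assms unfolding peirce_def by (simp add: l_distr r_distr)

lemma peirce_minus:
  assumes "g \<in> carrier R" "h \<in> carrier R" "x \<in> peirce R g h"
  shows "\<ominus> x \<in> peirce R g h"
  using assms unfolding peirce_def by (simp add: l_minus r_minus)

lemma peirce_prod:
  assumes "g \<in> carrier R" "k \<in> carrier R" "x \<in> peirce R g h" "y \<in> peirce R h k"
  shows "x \<otimes> y \<in> peirce R g k"
  using assms unfolding peirce_def by (simp add: m_assoc) (simp flip: m_assoc)

text \<open>The record \<open>A\<close> is left open so that rings and bimodules are covered at
  once.\<close>

lemma abelian_group_peirce:
  assumes "g \<in> carrier R" "h \<in> carrier R"
    and "carrier A = peirce R g h" "add A = add R" "zero A = \<zero>"
  shows "abelian_group A"
proof (rule abelian_groupI)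
  fix x assume "x \<in> carrier A"
  then show "\<exists>y \<in> carrier A. y \<oplus>\<^bsub>A\<^esub> x = \<zero>\<^bsub>A\<^esub>"
    using assms by (intro bexI[of _ "\<ominus> x"]) (auto simp: peirce_minus peirceD l_neg)
qed (use assms peirce_add peirce_zero in \<open>auto simp: peirceD a_ac\<close>)

text \<open>Serves both \<open>peirce_ring\<close> and \<open>corner\<close>, whose record types
  differ.\<close>

lemma ring_peirce:
  assumes g: "idempotent_elem R g"
    and A: "carrier A = peirce R g g" "add A = add R" "zero A = \<zero>" "mult A = mult R" "one A = g"
  shows "ring A"
proof (rule ringI)
  have gc: "g \<in> carrier R" using g by (rule idempotent_elemD)
  show "abelian_group A" using abelian_group_peirce[OF gc gc A(1-3)] .
  show "monoid A"
    using A peirce_prod[OF gc gc] peirce_idempotent[OF g]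
    by (intro monoidI) (auto simp: peirceD m_assoc)
qed (use A in \<open>auto simp: peirceD l_distr r_distr\<close>)

lemma ring_peirce_ring: "idempotent_elem R g \<Longrightarrow> ring (peirce_ring R g)"
  by (rule ring_peirce) (simp_all add: peirce_ring_def)

lemma bimodule_peirce:
  assumes g: "idempotent_elem R g" and h: "idempotent_elem R h"
  shows "bimodule (peirce_ring R g) (peirce_ring R h) (peirce_bimodule R g h)"
proof (intro bimodule.intro bimodule_axioms.intro)
  have c: "g \<in> carrier R" "h \<in> carrier R" using g h by (auto dest: idempotent_elemD)
  show "abelian_group (peirce_bimodule R g h)"
    by (rule abelian_group_peirce[OF c]) (simp_all add: peirce_bimodule_def)
  show "ring (peirce_ring R g)" "ring (peirce_ring R h)" using g h by (auto intro: ring_peirce_ring)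
qed (use g h in \<open>auto simp: peirce_ring_def peirce_bimodule_def peirceD
      idempotent_elemD l_distr r_distr m_assoc intro: peirce_prod\<close>)

text \<open>All actions and both pairings are multiplication in \<open>R\<close>, so the axioms
  reduce to associativity, distributivity and closure.\<close>

lemma morita_context_peirce:
  assumes g: "idempotent_elem R g" and h: "idempotent_elem R h"
  shows "morita_context (peirce_ring R g) (peirce_ring R h)
    (peirce_bimodule R g h) (peirce_bimodule R h g) (mult R) (mult R)"
  by (intro morita_context.intro bimodule_peirce g h morita_context_axioms.intro)
    (use g h in \<open>auto simp: peirce_ring_def peirce_bimodule_def peirceD
      idempotent_elemD l_distr r_distr m_assoc intro: peirce_prod\<close>)

section \<open>The isomorphism of a ring with its Peirce matrix ring\<close>

lemma peirce_orthogonal: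
  assumes x: "x \<in> peirce R g h"
  shows "\<lbrakk>h' \<in> carrier R; h \<in> carrier R; h \<otimes> h' = \<zero>\<rbrakk> \<Longrightarrow> x \<otimes> h' = \<zero>"
    and "\<lbrakk>g' \<in> carrier R; g \<in> carrier R; g' \<otimes> g = \<zero>\<rbrakk> \<Longrightarrow> g' \<otimes> x = \<zero>"
proof -
  note xc = peirceD(1)[OF x]
  assume "h' \<in> carrier R" "h \<in> carrier R" "h \<otimes> h' = \<zero>"
  then have "(x \<otimes> h) \<otimes> h' = \<zero>" using xc by (simp add: m_assoc)
  then show "x \<otimes> h' = \<zero>" using peirceD(3)[OF x] by simp
next
  note xc = peirceD(1)[OF x]
  assume "g' \<in> carrier R" "g \<in> carrier R" "g' \<otimes> g = \<zero>"
  then have "g' \<otimes> (g \<otimes> x) = \<zero>" using xc by (simp flip: m_assoc)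
  then show "g' \<otimes> x = \<zero>" using peirceD(2)[OF x] by simp
qed

lemma peirce_decomposition:
  assumes g: "idempotent_elem R g" and h: "idempotent_elem R h"
    and gh: "g \<otimes> h = \<zero>" "h \<otimes> g = \<zero>" "g \<oplus> h = \<one>"
  shows "R \<simeq> gen_matrix_ring (peirce_ring R g) (peirce_ring R h)
    (peirce_bimodule R g h) (peirce_bimodule R h g) (mult R) (mult R)" (is "R \<simeq> ?M")
proof -
  have c: "g \<in> carrier R" "h \<in> carrier R" using g h by (auto dest: idempotent_elemD)
  define \<theta> where "\<theta> r = (g \<otimes> r \<otimes> g, g \<otimes> r \<otimes> h, h \<otimes> r \<otimes> g, h \<otimes> r \<otimes> h)" for r
  have closed: "\<theta> r \<in> carrier ?M" if "r \<in> carrier R" for r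
    unfolding \<theta>_def using that g h peirce_mult
    by (simp add: gen_matrix_ring_def peirce_ring_def peirce_bimodule_def)
  \<comment> \<open>Inserting \<open>g \<oplus> h = \<one>\<close> between \<open>r\<close> and
    \<open>s\<close> is exactly the rule for a matrix entry of a product.\<close>
  have split: "a \<otimes> (r \<otimes> s) \<otimes> b = (a \<otimes> r \<otimes> g) \<otimes> (g \<otimes> s \<otimes> b) \<oplus> (a \<otimes> r \<otimes> h) \<otimes> (h \<otimes> s \<otimes> b)"
    if "a \<in> carrier R" "b \<in> carrier R" "r \<in> carrier R" "s \<in> carrier R" for a b r s
  proof -
    have "(a \<otimes> r \<otimes> g) \<otimes> (g \<otimes> s \<otimes> b) = a \<otimes> r \<otimes> (g \<otimes> g) \<otimes> (s \<otimes> b)"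
      "(a \<otimes> r \<otimes> h) \<otimes> (h \<otimes> s \<otimes> b) = a \<otimes> r \<otimes> (h \<otimes> h) \<otimes> (s \<otimes> b)"
      using that c by (simp_all only: m_assoc m_closed)
    then have "(a \<otimes> r \<otimes> g) \<otimes> (g \<otimes> s \<otimes> b) \<oplus> (a \<otimes> r \<otimes> h) \<otimes> (h \<otimes> s \<otimes> b)
        = a \<otimes> r \<otimes> (g \<oplus> h) \<otimes> (s \<otimes> b)"
      using that c g h by (simp add: idempotent_elemD l_distr r_distr)
    then show ?thesis using that gh by (simp add: m_assoc)
  qed
  have sum: "r = (g \<otimes> r \<otimes> g \<oplus> g \<otimes> r \<otimes> h) \<oplus> (h \<otimes> r \<otimes> g \<oplus> h \<otimes> r \<otimes> h)" if "r \<in> carrier R" for r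
  proof -
    have "r = (g \<oplus> h) \<otimes> r \<otimes> (g \<oplus> h)" using that unfolding gh by simp
    also have "\<dots> = (g \<otimes> r \<oplus> h \<otimes> r) \<otimes> (g \<oplus> h)" using that c by (simp add: l_distr)
    also have "\<dots> = g \<otimes> r \<otimes> (g \<oplus> h) \<oplus> h \<otimes> r \<otimes> (g \<oplus> h)" using that c by (simp add: l_distr)
    also have "\<dots> = (g \<otimes> r \<otimes> g \<oplus> g \<otimes> r \<otimes> h) \<oplus> (h \<otimes> r \<otimes> g \<oplus> h \<otimes> r \<otimes> h)"
      using that c by (simp add: r_distr)
    finally show ?thesis .
  qed
  have "\<theta> \<in> ring_hom R ?M"
  proof (rule ring_hom_memI)
    fix r s assume rs: "r \<in> carrier R" "s \<in> carrier R"
    show "\<theta> (r \<otimes> s) = \<theta> r \<otimes>\<^bsub>?M\<^esub> \<theta> s"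
      unfolding \<theta>_def
      by (simp add: gen_matrix_ring_def peirce_ring_def peirce_bimodule_def split[OF _ _ rs] c)
    show "\<theta> (r \<oplus> s) = \<theta> r \<oplus>\<^bsub>?M\<^esub> \<theta> s"
      unfolding \<theta>_def using rs c
      by (simp add: gen_matrix_ring_def peirce_ring_def peirce_bimodule_def l_distr r_distr)
  next
    show "\<theta> \<one> = \<one>\<^bsub>?M\<^esub>"
      unfolding \<theta>_def using c gh g h
      by (simp add: gen_matrix_ring_def peirce_ring_def peirce_bimodule_def idempotent_elemD)
  qed (rule closed)
  moreover have "bij_betw \<theta> (carrier R) (carrier ?M)"
    unfolding bij_betw_def
  proof (intro conjI inj_onI)
    fix r s assume rs: "r \<in> carrier R" "s \<in> carrier R" "\<theta> r = \<theta> s"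
    then show "r = s" using sum[of r] sum[of s] unfolding \<theta>_def by simp
  next
    have "m \<in> \<theta> ` carrier R" if "m \<in> carrier ?M" for m
    proof -
      obtain s x y l where m: "m = (s, x, y, l)" by (cases m)
      have p: "s \<in> peirce R g g" "x \<in> peirce R g h" "y \<in> peirce R h g" "l \<in> peirce R h h"
        using that unfolding m gen_matrix_ring_def peirce_ring_def peirce_bimodule_def by auto
      note simps = p[THEN peirceD(1)] p[THEN peirceD(2)] p[THEN peirceD(3)]
        p[THEN peirce_orthogonal(1)] p[THEN peirce_orthogonal(2)] c gh(1,2) l_distr r_distr
      \<comment> \<open>The preimage is the sum of the four entries; orthogonality of
        \<open>g\<close> and \<open>h\<close> kills all but one entry in each component.\<close>
      have "\<theta> (s \<oplus> x \<oplus> y \<oplus> l) = m" unfolding \<theta>_def m by (simp add: simps)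
      moreover have "s \<oplus> x \<oplus> y \<oplus> l \<in> carrier R" using p by (simp add: peirceD)
      ultimately show ?thesis by (metis image_eqI)
    qed
    then show "\<theta> ` carrier R = carrier ?M" using closed by blast
  qed
  ultimately show ?thesis unfolding is_ring_iso_def ring_iso_def by blast
qed

text \<open>Since \<open>g\<close> fixes \<open>a\<close> on both sides, an inner inverse
  \<open>b\<close> in \<open>R\<close> may be replaced by
  \<open>g \<otimes> b \<otimes> g\<close>.\<close>

lemma vn_regular_peirceE:
  assumes g: "idempotent_elem R g" and a: "a \<in> peirce R g g" and reg: "vn_regular R a"
  obtains b where "b \<in> peirce R g g" and "a \<otimes> b \<otimes> a = a"
proof -
  obtain b where b: "b \<in> carrier R" "a \<otimes> b \<otimes> a = a"
    using reg unfolding vn_regular_def by metis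
  have "a \<otimes> (g \<otimes> b \<otimes> g) \<otimes> a = (a \<otimes> g) \<otimes> b \<otimes> (g \<otimes> a)"
    using peirceD(1)[OF a] b(1) idempotent_elemD(1)[OF g] by (simp only: m_assoc m_closed)
  then show thesis using that[of "g \<otimes> b \<otimes> g"] b peirceD[OF a] peirce_mult[OF g g b(1)] by simp
qed

lemma regular_peirce_ring:
  assumes g: "idempotent_elem R g" and reg: "\<And>s. s \<in> peirce R g g \<Longrightarrow> vn_regular R s"
  shows "regular_ring (peirce_ring R g)"
  unfolding regular_ring_def
proof (intro conjI ballI ring_peirce_ring[OF g])
  fix s assume "s \<in> carrier (peirce_ring R g)"
  then have s: "s \<in> peirce R g g" by (simp add: peirce_ring_def)
  obtain b where "b \<in> peirce R g g" "s \<otimes> b \<otimes> s = s"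
    using vn_regular_peirceE[OF g s reg[OF s]] .
  then show "vn_regular (peirce_ring R g) s"
    using s by (intro vn_regularI[where b = b]) (simp_all add: peirce_ring_def)
qed

section \<open>Primitive idempotents and complementary corners of VNL rings\<close>

lemma primitive_idempotentD:
  assumes "primitive_idempotent R e"
  shows "idempotent_elem R e" "e \<noteq> \<zero>"
  using assms unfolding primitive_idempotent_def by auto

text \<open>Otherwise \<open>w\<close> and \<open>e \<ominus> w\<close> would split \<open>e\<close>
  into nonzero orthogonal idempotents.\<close>

lemma primitive_idempotent_corner:
  assumes e: "primitive_idempotent R e" and w: "w \<in> peirce R e e" "w \<otimes> w = w"
  shows "w = \<zero> \<or> w = e"
proof (rule ccontr)
  assume nt: "\<not> ?thesis"
  note idem = idempotent_elemD[OF primitive_idempotentD(1)[OF e]] and wD = peirceD[OF w(1)]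
  have "(e \<ominus> w) \<otimes> (e \<ominus> w) = e \<ominus> w" "w \<otimes> (e \<ominus> w) = \<zero>" "(e \<ominus> w) \<otimes> w = \<zero>"
    using idem wD w(2) by (simp_all add: minus_eq l_distr r_distr l_minus r_minus r_neg)
  moreover have sum: "e = w \<oplus> (e \<ominus> w)" using idem(1) wD(1) by algebra
  moreover have "e \<ominus> w \<noteq> \<zero>" using sum wD(1) nt by auto
  ultimately show False
    using e nt idem(1) wD(1) w(2) unfolding primitive_idempotent_def idempotent_elem_def
    by (meson minus_closed)
qed

text \<open>With an inner inverse \<open>b\<close> taken inside the corner,
  \<open>a \<otimes> b\<close> and \<open>b \<otimes> a\<close> are nonzero idempotents there, so
  both equal \<open>e\<close>.\<close>

lemma primitive_regular_unit:
  assumes e: "primitive_idempotent R e"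
    and a: "a \<in> peirce R e e" "vn_regular R a" "a \<noteq> \<zero>"
  shows "a \<in> Units (peirce_ring R e)"
proof -
  note idem = primitive_idempotentD(1)[OF e] and aD = peirceD[OF a(1)]
  obtain b where b: "b \<in> peirce R e e" "a \<otimes> b \<otimes> a = a" using vn_regular_peirceE[OF idem a(1,2)] .
  note bD = peirceD[OF b(1)] and ec = idempotent_elemD(1)[OF idem]
  have aba: "a \<otimes> (b \<otimes> a) = a" using b(2) aD(1) bD(1) by (simp add: m_assoc)
  have "(a \<otimes> b) \<otimes> (a \<otimes> b) = (a \<otimes> b \<otimes> a) \<otimes> b" "(b \<otimes> a) \<otimes> (b \<otimes> a) = b \<otimes> (a \<otimes> b \<otimes> a)"
    using aD(1) bD(1) by (simp_all only: m_assoc m_closed)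
  then have "a \<otimes> b = \<zero> \<or> a \<otimes> b = e" "b \<otimes> a = \<zero> \<or> b \<otimes> a = e"
    using primitive_idempotent_corner[OF e] peirce_prod[OF ec ec] a(1) b by auto
  moreover have "a \<otimes> b \<noteq> \<zero>" using b(2) a(3) aD(1) by auto
  moreover have "b \<otimes> a \<noteq> \<zero>" using aba a(3) aD(1) by auto
  ultimately show ?thesis
    using a(1) b(1) by (intro UnitsI[where b = b]) (simp_all add: peirce_ring_def)
qed

text \<open>Compressing \<open>\<one> \<ominus> a\<close> by \<open>e\<close> gives
  \<open>e \<ominus> a\<close>, so VNL makes \<open>a\<close> or \<open>e \<ominus> a\<close>
  regular, and a nonzero regular element of the corner is a unit.\<close>

lemma local_peirce_ring:
  assumes VNL: "VNL_ring R" and e: "primitive_idempotent R e"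
  shows "local_ring (peirce_ring R e)" (is "local_ring ?L")
proof -
  note idem = primitive_idempotentD(1)[OF e]
  note ec = idempotent_elemD(1)[OF idem]
  interpret L: ring ?L by (rule ring_peirce_ring[OF idem])
  have e_unit: "e \<in> Units ?L" using L.Units_one_closed by (simp add: peirce_ring_def)
  show ?thesis
  proof (rule L.local_ringI)
    show "\<one>\<^bsub>?L\<^esub> \<noteq> \<zero>\<^bsub>?L\<^esub>" using primitive_idempotentD(2)[OF e] by (simp add: peirce_ring_def)
    fix a assume "a \<in> carrier ?L"
    then have a: "a \<in> peirce R e e" by (simp add: peirce_ring_def)
    note aD = peirceD[OF a]
    have ea: "e \<ominus> a \<in> peirce R e e"
      unfolding minus_eq using a ec peirce_idempotent[OF idem] by (intro peirce_add peirce_minus)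
    \<comment> \<open>Subtraction in \<open>?L\<close> is defined through its own additive inverses;
      cancelling \<open>a\<close> identifies it with subtraction in \<open>R\<close>.\<close>
    have "\<one>\<^bsub>?L\<^esub> \<ominus>\<^bsub>?L\<^esub> a \<oplus>\<^bsub>?L\<^esub> a = \<one>\<^bsub>?L\<^esub>"
      using \<open>a \<in> carrier ?L\<close> by (simp add: L.minus_eq L.a_assoc L.l_neg)
    then have "(\<one>\<^bsub>?L\<^esub> \<ominus>\<^bsub>?L\<^esub> a) \<oplus> a = (e \<ominus> a) \<oplus> a"
      using aD(1) ec by (simp add: peirce_ring_def minus_eq a_assoc l_neg)
    moreover have "\<one>\<^bsub>?L\<^esub> \<ominus>\<^bsub>?L\<^esub> a \<in> carrier R"
      using L.minus_closed[OF L.one_closed \<open>a \<in> carrier ?L\<close>] peirceD(1)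
      unfolding peirce_ring_def by fastforce
    ultimately have minus: "\<one>\<^bsub>?L\<^esub> \<ominus>\<^bsub>?L\<^esub> a = e \<ominus> a"
      using aD(1) ec by (meson add.right_cancel minus_closed)
    have "vn_regular R (e \<ominus> a)" if "vn_regular R (\<one> \<ominus> a)"
    proof -
      have "e \<otimes> (\<one> \<ominus> a) = e \<ominus> a" "(\<one> \<ominus> a) \<otimes> e = e \<ominus> a"
        using aD ec by (simp_all add: minus_eq l_distr r_distr l_minus r_minus)
      then show ?thesis using vn_regular_commuting_idempotent[OF idem that] by simp
    qed
    then have "vn_regular R a \<or> vn_regular R (e \<ominus> a)"
      using VNL aD(1) unfolding VNL_ring_def by blast
    \<comment> \<open>If the regular one of the two elements is zero, the other one is the unit
      \<open>e\<close>.\<close>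
    moreover have "e \<ominus> a = e" if "a = \<zero>" using that ec by (simp add: minus_eq)
    moreover have "a = e" if "e \<ominus> a = \<zero>"
    proof -
      have "e = a \<oplus> (e \<ominus> a)" using ec aD(1) by algebra
      then show ?thesis using that aD(1) by simp
    qed
    ultimately show "a \<in> Units ?L \<or> \<one>\<^bsub>?L\<^esub> \<ominus>\<^bsub>?L\<^esub> a \<in> Units ?L"
      unfolding minus using primitive_regular_unit[OF e] a ea e_unit by metis
  qed
qed

text \<open>The corner has a nonzero nonunit, and by \<open>primitive_regular_unit\<close> this
  element cannot be regular.\<close>

lemma exists_not_vn_regular:
  assumes e: "primitive_idempotent R e" and nd: "\<not> division_ring (corner R e)"
  obtains a where "a \<in> peirce R e e" and "\<not> vn_regular R a"
proof -
  note idem = primitive_idempotentD(1)[OF e]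
  have corner: "carrier (corner R e) = peirce R e e" "Units (corner R e) = Units (peirce_ring R e)"
    using carrier_corner[OF idem] by (simp_all add: Units_def) (simp add: corner_def peirce_ring_def)
  have "ring (corner R e)" by (rule ring_peirce[OF idem corner(1)]) (simp_all add: corner_def)
  moreover have ne: "\<one>\<^bsub>corner R e\<^esub> \<noteq> \<zero>\<^bsub>corner R e\<^esub>"
    using primitive_idempotentD(2)[OF e] by (simp add: corner_def)
  ultimately have "Units (corner R e) \<noteq> peirce R e e - {\<zero>}"
    using nd corner(1) unfolding division_ring_def by (simp add: corner_def)
  moreover have "\<zero> \<notin> Units (corner R e)"
    using ne peirceD(1) unfolding corner(2)
    by (auto simp: Units_def corner_def peirce_ring_def)
  moreover have "Units (corner R e) \<subseteq> peirce R e e" using corner(1) by (auto simp: Units_def)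
  ultimately obtain a where "a \<in> peirce R e e" "a \<noteq> \<zero>" "a \<notin> Units (peirce_ring R e)"
    using corner(2) by blast
  then show thesis using that primitive_regular_unit[OF e] by blast
qed

text \<open>Compression is used twice: \<open>u\<close> has the bad block \<open>a\<close> at
  \<open>e\<close>, so \<open>\<one> \<ominus> u\<close> must be regular, and \<open>u\<close> is
  chosen so that the block of \<open>\<one> \<ominus> u\<close> at \<open>f\<close> is
  \<open>s\<close>.\<close>

lemma vn_regular_complement:
  assumes VNL: "VNL_ring R" and e: "idempotent_elem R e" and f: "idempotent_elem R f"
    and ef: "e \<otimes> f = \<zero>" "f \<otimes> e = \<zero>"
    and a: "a \<in> peirce R e e" "\<not> vn_regular R a" and s: "s \<in> peirce R f f"
  shows "vn_regular R s"
proof -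
  note c = idempotent_elemD(1)[OF e] idempotent_elemD(1)[OF f]
  note simps = peirceD[OF a(1)] peirceD[OF s] c ef idempotent_elemD[OF f] minus_eq
    peirce_orthogonal[OF a(1)] peirce_orthogonal[OF s] l_distr r_distr l_minus r_minus minus_add
  define u where "u = a \<oplus> (f \<ominus> s)"
  have u: "u \<in> carrier R" unfolding u_def by (simp add: simps)
  have "e \<otimes> u = a" "u \<otimes> e = a" unfolding u_def by (simp_all add: simps)
  then have "\<not> vn_regular R u" using vn_regular_commuting_idempotent[OF e, of u] a(2) by auto
  then have "vn_regular R (\<one> \<ominus> u)" using VNL u unfolding VNL_ring_def by blast
  moreover have "f \<otimes> (\<one> \<ominus> u) = s" "(\<one> \<ominus> u) \<otimes> f = s"
    unfolding u_def by (simp_all add: simps r_neg2 r_neg)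
  ultimately show ?thesis using vn_regular_commuting_idempotent[OF f, of "\<one> \<ominus> u"] by simp
qed

text \<open>If \<open>xy \<noteq> 0\<close>, regularity of \<open>xy\<close> makes \<open>e\<close> isomorphic to an idempotent of
  \<open>fRf\<close>: there is \<open>z\<close> with \<open>zx = e\<close>.  Then \<open>a \<mapsto> xaz\<close> carries
  non-regular elements of \<open>eRe\<close> into \<open>fRf\<close>.\<close>

lemma peirce_prod_zero:
  assumes e: "primitive_idempotent R e" and f: "idempotent_elem R f"
    and reg: "\<And>s. s \<in> peirce R f f \<Longrightarrow> vn_regular R s"
    and a: "a \<in> peirce R e e" "\<not> vn_regular R a"
    and x: "x \<in> peirce R f e" and y: "y \<in> peirce R e f"
  shows "x \<otimes> y = \<zero>"
proof (rule ccontr)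
  assume nz: "x \<otimes> y \<noteq> \<zero>"
  note idem = primitive_idempotentD(1)[OF e]
  note c = idempotent_elemD(1)[OF idem] idempotent_elemD(1)[OF f]
  have p: "x \<otimes> y \<in> peirce R f f" using peirce_prod x y c by blast
  obtain t where t: "t \<in> peirce R f f" "(x \<otimes> y) \<otimes> t \<otimes> (x \<otimes> y) = x \<otimes> y"
    using vn_regular_peirceE[OF f p reg[OF p]] .
  note cl = peirceD(1)[OF x] peirceD(1)[OF y] peirceD(1)[OF t(1)] peirceD(1)[OF a(1)]
  \<comment> \<open>Put \<open>p = x \<otimes> y\<close>. Using \<open>tpt\<close> in place of
    \<open>t\<close> gives \<open>(tpt)p(tpt) = tpt\<close>, which is what makes
    \<open>z \<otimes> x = y(tpt)x\<close> idempotent.\<close>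
  define z where "z = y \<otimes> t \<otimes> (x \<otimes> y) \<otimes> t"
  have z: "z \<in> peirce R e f" unfolding z_def using peirce_prod c y t(1) p by meson
  note zc = peirceD(1)[OF z]
  have zx: "z \<otimes> x \<in> peirce R e e" using peirce_prod c x z by blast
  have "z \<otimes> x \<otimes> (z \<otimes> x) = y \<otimes> t \<otimes> ((x \<otimes> y \<otimes> t \<otimes> (x \<otimes> y)) \<otimes> t \<otimes> (x \<otimes> y)) \<otimes> t \<otimes> x"
    unfolding z_def using cl by (simp only: m_assoc m_closed)
  then have "z \<otimes> x \<otimes> (z \<otimes> x) = z \<otimes> x" unfolding t(2) z_def using cl by (simp only: m_assoc m_closed)
  \<comment> \<open>Multiplying by \<open>x\<close> on the left and \<open>y\<close> on the right
    gives \<open>ptptp = p\<close>, which is nonzero.\<close>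
  moreover have "z \<otimes> x \<noteq> \<zero>"
  proof
    assume "z \<otimes> x = \<zero>"
    then have "x \<otimes> (z \<otimes> x) \<otimes> y = \<zero>" using cl by simp
    moreover have "x \<otimes> (z \<otimes> x) \<otimes> y = (x \<otimes> y \<otimes> t \<otimes> (x \<otimes> y)) \<otimes> t \<otimes> (x \<otimes> y)"
      unfolding z_def using cl by (simp only: m_assoc m_closed)
    ultimately show False using t(2) nz by simp
  qed
  ultimately have zx_e: "z \<otimes> x = e" using primitive_idempotent_corner[OF e zx] by blast
  have "x \<otimes> a \<otimes> z \<in> peirce R f f" using peirce_prod c x z a(1) by meson
  then obtain b where b: "b \<in> carrier R" "(x \<otimes> a \<otimes> z) \<otimes> b \<otimes> (x \<otimes> a \<otimes> z) = x \<otimes> a \<otimes> z"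
    using reg unfolding vn_regular_def by metis
  \<comment> \<open>Enclosing the regularity equation of \<open>x \<otimes> a \<otimes> z\<close>
    between \<open>z\<close> and \<open>x\<close> pulls it back to \<open>a\<close>, as
    \<open>z \<otimes> x = e\<close>.\<close>
  have "z \<otimes> ((x \<otimes> a \<otimes> z) \<otimes> b \<otimes> (x \<otimes> a \<otimes> z)) \<otimes> x
      = ((z \<otimes> x) \<otimes> a) \<otimes> (z \<otimes> b \<otimes> x) \<otimes> (a \<otimes> (z \<otimes> x))"
    using cl zc b(1) by (simp only: m_assoc m_closed)
  moreover have "z \<otimes> (x \<otimes> a \<otimes> z) \<otimes> x = ((z \<otimes> x) \<otimes> a) \<otimes> (z \<otimes> x)"
    using cl zc by (simp only: m_assoc m_closed)
  ultimately have "a \<otimes> (z \<otimes> b \<otimes> x) \<otimes> a = a" using b(2) zx_e peirceD[OF a(1)] by simp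
  then have "vn_regular R a" using cl zc b(1) by (intro vn_regularI[where b = "z \<otimes> b \<otimes> x"]) auto
  then show False using a(2) by simp
qed

end

section \<open>Vanishing of \<open>XY\<close> and the equivalence\<close>

lemma pairing_sums_eq_zero:
  assumes "abelian_monoid S" and "\<And>x y. x \<in> carrier X \<Longrightarrow> y \<in> carrier Y \<Longrightarrow> \<phi> x y = \<zero>\<^bsub>S\<^esub>"
  shows "pairing_sums S X Y \<phi> = {\<zero>\<^bsub>S\<^esub>}"
proof -
  interpret abelian_monoid S by fact
  have "(\<Oplus>\<^bsub>S\<^esub>i\<in>{..<n}. \<phi> (f i) (g i)) = \<zero>\<^bsub>S\<^esub>"
    if "f \<in> {..<n} \<rightarrow> carrier X" "g \<in> {..<n} \<rightarrow> carrier Y" for n :: nat and f g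
    using that assms(2) by (intro add.finprod_one_eqI) auto
  \<comment> \<open>The empty sum, \<open>n = 0\<close>, is what makes the set nonempty.\<close>
  moreover have "\<zero>\<^bsub>S\<^esub> \<in> pairing_sums S X Y \<phi>"
    unfolding pairing_sums_def by (auto intro!: exI[of _ "0::nat"])
  ultimately show ?thesis unfolding pairing_sums_def by auto
qed

theorem theorem4p8:
  fixes R :: "('a, 'm) ring_scheme" and e :: 'a
  assumes "ring R"
    and "primitive_idempotent R e"
    and "\<not> division_ring (corner R e)"
  shows "(VNL_ring R \<longrightarrow>
           (\<exists>(S :: 'a ring) (L :: 'a ring) (X :: ('a, 'a, 'a) bimodule) (Y :: ('a, 'a, 'a) bimodule)
              (\<phi> :: 'a \<Rightarrow> 'a \<Rightarrow> 'a) (\<psi> :: 'a \<Rightarrow> 'a \<Rightarrow> 'a).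
              morita_context S L X Y \<phi> \<psi> \<and> R \<simeq> gen_matrix_ring S L X Y \<phi> \<psi> \<and>
              local_ring L \<and> regular_ring S \<and> pairing_sums S X Y \<phi> = {\<zero>\<^bsub>S\<^esub>})) \<and>
         ((\<exists>(S :: 's ring) (L :: 'l ring) (X :: ('s, 'l, 'x) bimodule) (Y :: ('l, 's, 'y) bimodule)
              (\<phi> :: 'x \<Rightarrow> 'y \<Rightarrow> 's) (\<psi> :: 'y \<Rightarrow> 'x \<Rightarrow> 'l).
              morita_context S L X Y \<phi> \<psi> \<and> R \<simeq> gen_matrix_ring S L X Y \<phi> \<psi> \<and>
              local_ring L \<and> regular_ring S \<and> pairing_sums S X Y \<phi> = {\<zero>\<^bsub>S\<^esub>}) \<longrightarrow>
          VNL_ring R)"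
proof (intro conjI impI)
  interpret ring R by fact
  note e = assms(2) and idem = primitive_idempotentD(1)[OF assms(2)]
  note eD = idempotent_elemD[OF idem]
  assume VNL: "VNL_ring R"
  \<comment> \<open>\<open>f\<close> takes the upper left position and \<open>e\<close> the lower
    right one: \<open>S = fRf\<close>, \<open>X = fRe\<close>, \<open>Y = eRf\<close>,
    \<open>L = eRe\<close>.\<close>
  define f where "f = \<one>\<^bsub>R\<^esub> \<ominus>\<^bsub>R\<^esub> e"
  have f: "idempotent_elem R f" "f \<otimes>\<^bsub>R\<^esub> e = \<zero>\<^bsub>R\<^esub>" "e \<otimes>\<^bsub>R\<^esub> f = \<zero>\<^bsub>R\<^esub>" "f \<oplus>\<^bsub>R\<^esub> e = \<one>\<^bsub>R\<^esub>"
    unfolding f_def idempotent_elem_def using eD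
    by (simp_all add: minus_eq l_distr r_distr l_minus r_minus r_neg l_neg a_assoc)
  obtain a where a: "a \<in> peirce R e e" "\<not> vn_regular R a"
    using exists_not_vn_regular[OF e assms(3)] .
  have reg: "vn_regular R s" if "s \<in> peirce R f f" for s
    using vn_regular_complement[OF VNL idem f(1,3,2) a that] .
  have "pairing_sums (peirce_ring R f) (peirce_bimodule R f e) (peirce_bimodule R e f) (mult R)
      = {\<zero>\<^bsub>peirce_ring R f\<^esub>}"
  proof (rule pairing_sums_eq_zero)
    interpret S: ring "peirce_ring R f" by (rule ring_peirce_ring[OF f(1)])
    show "abelian_monoid (peirce_ring R f)" by (rule S.abelian_monoid_axioms)
  qed (use peirce_prod_zero[OF e f(1) reg a] in
      \<open>simp add: peirce_ring_def peirce_bimodule_def\<close>)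
  then show "\<exists>(S :: 'a ring) (L :: 'a ring) (X :: ('a, 'a, 'a) bimodule) (Y :: ('a, 'a, 'a) bimodule)
      (\<phi> :: 'a \<Rightarrow> 'a \<Rightarrow> 'a) (\<psi> :: 'a \<Rightarrow> 'a \<Rightarrow> 'a).
      morita_context S L X Y \<phi> \<psi> \<and> R \<simeq> gen_matrix_ring S L X Y \<phi> \<psi> \<and>
      local_ring L \<and> regular_ring S \<and> pairing_sums S X Y \<phi> = {\<zero>\<^bsub>S\<^esub>}"
    using morita_context_peirce[OF f(1) idem] peirce_decomposition[OF f(1) idem f(2-4)]
      local_peirce_ring[OF VNL e] regular_peirce_ring[OF f(1) reg] by blast
next
  assume "\<exists>(S :: 's ring) (L :: 'l ring) (X :: ('s, 'l, 'x) bimodule) (Y :: ('l, 's, 'y) bimodule)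
      (\<phi> :: 'x \<Rightarrow> 'y \<Rightarrow> 's) (\<psi> :: 'y \<Rightarrow> 'x \<Rightarrow> 'l).
      morita_context S L X Y \<phi> \<psi> \<and> R \<simeq> gen_matrix_ring S L X Y \<phi> \<psi> \<and>
      local_ring L \<and> regular_ring S \<and> pairing_sums S X Y \<phi> = {\<zero>\<^bsub>S\<^esub>}"
  then show "VNL_ring R"
    using VNL_ring_iso[OF assms(1)] morita_context.VNL_gen_matrix_ring by blast
qed

end
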